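(* Let $\mathcal{P}\subset\mathbb{R}^2$ be a point cloud and let $y_{\min},y_{\max}\in\mathbb{R}$ satisfy $y_{\min}\le y\le y_{\max}$ for all $(x,y)\in\mathcal{P}$. Let $f_w$ be the weighted quasi interpolant spline approximation to $\mathcal{P}$ of degree $p$ over a $(p+1)$-regular knot vector $\mathbf{x}=[x_1,\dots,x_{n+p+1}]$, with respect to a family of weight functions $w_t:\mathbb{R}\to[0,+\infty)$, $t\in\mathbb{R}$. Then for every $\mu$ with $p+1\le\mu\le n$ there exist $\alpha(\mu),\beta(\mu)\in[y_{\min},y_{\max}]$ such that $$\alpha(\mu)\le f_w(x)\le\beta(\mu)\quad\text{for all }x\in[x_\mu,x_{\mu+1}).$$
   Context: A point cloud is a finite nonempty set of points. B-splines. For a non-decreasing local knot vector $\mathbf{t}=[t_1,\dots,t_{p+2}]$, the B-spline $B[\mathbf{t}]:\mathbb{R}\to\mathbb{R}$ of degree $p$ is defined recursively by $$B[\mathbf{t}](x)=\frac{x-t_1}{t_{p+1}-t_1}B[t_1,\dots,t_{p+1}](x)+\frac{t_{p+2}-x}{t_{p+2}-t_2}B[t_2,\dots,t_{p+2}](x),$$ with $B[t_i,t_{i+1}](x)=1$ if $x\in[t_i,t_{i+1})$ and $0$ otherwise; terms with zero denominator are taken to be $0$ (convention $0/0=0$). For a global non-decreasing knot vector $\mathbf{x}=[x_1,\dots,x_{n+p+1}]$ put $\mathbf{x}^{(i)}=[x_i,\dots,x_{i+p+1}]$, $i=1,\dots,n$. A knot vector $\mathbf{x}=[x_1,\dots,x_{n+p+1}]$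 is $(p+1)$-regular if $n\ge p+1$, $x_1=x_{p+1}$, $x_{n+1}=x_{n+p+1}$, and $x_j<x_{j+p+1}$ for $j=1,\dots,n$. Weighted quasi interpolant spline approximation (wQISA). Let $p\ge1$ be an integer. The wQISA of degree $p$ to $\mathcal{P}$ over $\mathbf{x}$ is $$f_w(x)=\sum_{i=1}^n\hat y_w(\xi^{(i)})\,B[\mathbf{x}^{(i)}](x),$$ where $\xi^{(i)}=(x_{i+1}+\dots+x_{i+p})/p$ are the knot averages and $$\hat y_w(t)=\frac{\sum_{(x,y)\in\mathcal{P}}y\,w_t(x)}{\sum_{(x,y)\in\mathcal{P}}w_t(x)}.$$ It is assumed that the denominator is positive at each $t=\xi^{(i)}$, so that $f_w$ is well defined. *)

theory Defs
  imports Complex_Main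
begin

definition point_cloud :: "'a set \<Rightarrow> bool" where
  "point_cloud P \<longleftrightarrow> finite P \<and> P \<noteq> {}"

text \<open>
  A knot vector of length \<open>m\<close> is a function \<open>nat \<Rightarrow> real\<close> of which only the values
  at the indices \<open>1, \<dots>, m\<close> matter.
\<close>

definition knot_vector :: "nat \<Rightarrow> (nat \<Rightarrow> real) \<Rightarrow> bool" where
  "knot_vector m t \<longleftrightarrow> (\<forall>i\<in>{1..m}. \<forall>j\<in>{1..m}. i \<le> j \<longrightarrow> t i \<le> t j)"

text \<open>
  \<open>bspline p t\<close> is the B-spline of degree \<open>p\<close> on the local knot vector
  \<open>[t 1, \<dots>, t (p + 2)]\<close>; the shift \<open>\<lambda>j. t (j + 1)\<close> is the knot vector starting
  at \<open>t 2\<close>.  A term with denominator zero is zero, because \<open>u / 0 = 0\<close> in HOL.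
\<close>

fun bspline :: "nat \<Rightarrow> (nat \<Rightarrow> real) \<Rightarrow> real \<Rightarrow> real" where
  "bspline 0 t x = (if t 1 \<le> x \<and> x < t 2 then 1 else 0)"
| "bspline (Suc q) t x =
    (let p = Suc q in
      (x - t 1) / (t (p + 1) - t 1) * bspline q t x
      + (t (p + 2) - x) / (t (p + 2) - t 2) * bspline q (\<lambda>j. t (j + 1)) x)"

text \<open>\<open>[X i, X (i + 1), \<dots>]\<close>, indexed from \<open>1\<close>.\<close>

definition local_knots :: "(nat \<Rightarrow> real) \<Rightarrow> nat \<Rightarrow> nat \<Rightarrow> real" where
  "local_knots X i = (\<lambda>j. X (i + j - 1))"

text \<open>\<open>(p + 1)\<close>-regularity of the knot vector \<open>[X 1, \<dots>, X (n + p + 1)]\<close>.\<close>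

definition regular_knot_vector :: "nat \<Rightarrow> nat \<Rightarrow> (nat \<Rightarrow> real) \<Rightarrow> bool" where
  "regular_knot_vector p n X \<longleftrightarrow>
     knot_vector (n + p + 1) X \<and> n \<ge> p + 1 \<and> X 1 = X (p + 1) \<and>
     X (n + 1) = X (n + p + 1) \<and> (\<forall>j\<in>{1..n}. X j < X (j + p + 1))"

definition knot_average :: "nat \<Rightarrow> (nat \<Rightarrow> real) \<Rightarrow> nat \<Rightarrow> real" where
  "knot_average p X i = (\<Sum>k=i+1..i+p. X k) / real p"

definition weighted_mean :: "(real \<times> real) set \<Rightarrow> (real \<Rightarrow> real \<Rightarrow> real) \<Rightarrow> real \<Rightarrow> real" where
  "weighted_mean P w t = (\<Sum>(x, y)\<in>P. y * w t x) / (\<Sum>(x, y)\<in>P. w t x)"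

definition wQISA ::
  "(real \<times> real) set \<Rightarrow> (real \<Rightarrow> real \<Rightarrow> real) \<Rightarrow> nat \<Rightarrow> nat \<Rightarrow> (nat \<Rightarrow> real) \<Rightarrow> real \<Rightarrow> real" where
  "wQISA P w p n X x =
     (\<Sum>i=1..n. weighted_mean P w (knot_average p X i) * bspline p (local_knots X i) x)"

end

theory Submission
  imports Defs
begin

text \<open>
  On an interval \<open>[X \<mu>, X (\<mu> + 1))\<close> with \<open>p + 1 \<le> \<mu> \<le> n\<close> the B-splines of degree \<open>p\<close> are
  nonnegative (\<open>bspline_nonneg\<close>) and add up to \<open>1\<close> (\<open>sum_bspline_eq_1\<close>).  There the
  approximation is therefore a convex combination of its coefficients.  Each coefficient is in
  turn a weighted mean of the ordinates of the cloud with nonnegative weights, so it lies in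
  \<open>[ymin, ymax]\<close> (\<open>weighted_mean_bounds\<close>), and so does every convex combination of the
  coefficients.  Hence \<open>\<alpha> = ymin\<close> and \<open>\<beta> = ymax\<close> are admissible for every \<open>\<mu>\<close>.

  The partition of unity is proved by induction on the degree.  In the recursion the B-spline
  of lower degree on a given local knot vector is shared by two neighbours, with coefficients
  \<open>\<omega>\<close> and \<open>1 - \<omega>\<close>; the two B-splines without a second neighbour in the sum vanish on the
  interval by the local support property (\<open>bspline_support\<close>).
\<close>

lemma knot_vector_shift:
  assumes "knot_vector m t" and "k + l \<le> m"
  shows "knot_vector l (\<lambda>j. t (j + k))"
  using assms by (auto simp: knot_vector_def)

lemma knot_vector_local_knots:
  assumes "knot_vector m X" and "i \<ge> 1" and "i + l \<le> m + 1"
  shows "knot_vector l (local_knots X i)"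
  unfolding knot_vector_def local_knots_def
proof (intro ballI impI)
  fix j k assume "j \<in> {1..l}" "k \<in> {1..l}" "j \<le> k"
  then have "i + j - 1 \<in> {1..m}" "i + k - 1 \<in> {1..m}" "i + j - 1 \<le> i + k - 1"
    using assms(2,3) by auto
  then show "X (i + j - 1) \<le> X (i + k - 1)"
    using assms(1) by (simp add: knot_vector_def)
qed

lemma bspline_support:
  assumes "knot_vector (q + 2) t" and "bspline q t x \<noteq> 0"
  shows "t 1 \<le> x \<and> x < t (q + 2)"
  using assms
proof (induction q arbitrary: t)
  case 0
  then show ?case by (auto split: if_splits simp: numeral_2_eq_2)
next
  case (Suc q)
  have kv: "knot_vector (q + 2) t" "knot_vector (q + 2) (\<lambda>j. t (j + 1))"
    using Suc.prems(1) knot_vector_shift[of "Suc q + 2" t 0 "q + 2"]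
      knot_vector_shift[of "Suc q + 2" t 1 "q + 2"] by simp_all
  have le: "t 1 \<le> t 2" "t (q + 2) \<le> t (q + 3)"
    using Suc.prems(1) by (auto simp: knot_vector_def)
  have "bspline q t x \<noteq> 0 \<or> bspline q (\<lambda>j. t (j + 1)) x \<noteq> 0"
    using Suc.prems(2) by (auto simp: Let_def)
  then show ?case
  proof
    assume "bspline q t x \<noteq> 0"
    from Suc.IH[OF kv(1) this] le show ?thesis by (simp add: numeral_eq_Suc)
  next
    assume "bspline q (\<lambda>j. t (j + 1)) x \<noteq> 0"
    from Suc.IH[OF kv(2) this] le show ?thesis by (simp add: numeral_eq_Suc)
  qed
qed

text \<open>
  The coefficients of the recursion are nonnegative only on the support of the B-spline that
  they multiply, so nonnegativity rests on the local support property.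
\<close>

lemma bspline_nonneg:
  assumes "knot_vector (q + 2) t"
  shows "bspline q t x \<ge> 0"
  using assms
proof (induction q arbitrary: t)
  case 0
  then show ?case by simp
next
  case (Suc q)
  have kv: "knot_vector (q + 2) t" "knot_vector (q + 2) (\<lambda>j. t (j + 1))"
    using Suc.prems knot_vector_shift[of "Suc q + 2" t 0 "q + 2"]
      knot_vector_shift[of "Suc q + 2" t 1 "q + 2"] by simp_all
  have le: "t 1 \<le> t (q + 2)" "t 2 \<le> t (q + 3)"
    using Suc.prems by (auto simp: knot_vector_def)
  have "(x - t 1) / (t (q + 2) - t 1) * bspline q t x \<ge> 0"
    using bspline_support[OF kv(1), of x] Suc.IH[OF kv(1)] le(1)
    by (cases "bspline q t x = 0") auto
  moreover have "(t (q + 3) - x) / (t (q + 3) - t 2) * bspline q (\<lambda>j. t (j + 1)) x \<ge> 0"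
    using bspline_support[OF kv(2), of x] Suc.IH[OF kv(2)] le(2)
    by (cases "bspline q (\<lambda>j. t (j + 1)) x = 0") (auto simp: numeral_eq_Suc)
  ultimately show ?case by (simp add: Let_def numeral_eq_Suc)
qed

lemma bspline_local_knots_Suc:
  "bspline (Suc q) (local_knots X i) x =
     (x - X i) / (X (i + q + 1) - X i) * bspline q (local_knots X i) x
     + (X (i + q + 2) - x) / (X (i + q + 2) - X (i + 1)) * bspline q (local_knots X (i + 1)) x"
proof -
  have "(\<lambda>j. local_knots X i (j + 1)) = local_knots X (i + 1)"
    by (simp add: local_knots_def)
  then show ?thesis by (simp add: Let_def local_knots_def)
qed

lemma bspline_local_knots_eq_0:
  assumes "knot_vector m X" and "i \<ge> 1" and "i + q + 1 \<le> m"
    and "x < X i \<or> X (i + q + 1) \<le> x"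
  shows "bspline q (local_knots X i) x = 0"
proof (rule ccontr)
  assume nz: "bspline q (local_knots X i) x \<noteq> 0"
  have "knot_vector (q + 2) (local_knots X i)"
    by (rule knot_vector_local_knots[OF assms(1)]) (use assms(2,3) in auto)
  from bspline_support[OF this nz] show False
    using assms(4) by (auto simp: local_knots_def)
qed

text \<open>
  The knot interval is \<open>[X \<mu>, X (\<mu> + 1))\<close> with \<open>\<mu> = a + q\<close>: counting from the first
  B-spline \<open>a\<close> that is active on it avoids subtraction.  The bound on \<open>m\<close> says that the
  knots of the last active B-spline belong to the knot vector.
\<close>

lemma sum_bspline_eq_1:
  assumes "knot_vector m X" and "a \<ge> 1" and "a + 2 * q + 1 \<le> m"
    and "X (a + q) \<le> x" and "x < X (a + q + 1)"
  shows "(\<Sum>i=a..a + q. bspline q (local_knots X i) x) = 1"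
  using assms(2-)
proof (induction q arbitrary: a)
  case 0
  then show ?case by (simp add: local_knots_def)
next
  case (Suc q)
  let ?B = "\<lambda>i. bspline q (local_knots X i) x"
  define \<omega> where "\<omega> i = (x - X i) / (X (i + q + 1) - X i)" for i
  define \<psi> where "\<psi> i = (X (i + q + 1) - x) / (X (i + q + 1) - X i)" for i
  let ?M = "{a + 1..a + 1 + q}"
  have compl: "\<omega> i + \<psi> i = 1" if "i \<in> ?M" for i
  proof -
    \<comment> \<open>The interval is nonempty and lies between these two knots, so they are distinct.\<close>
    have "X i \<le> X (a + Suc q)" "X (a + Suc q + 1) \<le> X (i + q + 1)"
      using assms(1) Suc.prems that by (auto simp: knot_vector_def)
    then have "X i < X (i + q + 1)" using Suc.prems by linarith
    then show ?thesis by (simp add: \<omega>_def \<psi>_def flip: add_divide_distrib)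
  qed
  have ends: "?B a = 0" "?B (a + q + 2) = 0"
    using Suc.prems by (auto intro!: bspline_local_knots_eq_0[OF assms(1)])
  have "(\<Sum>i=a..a + Suc q. bspline (Suc q) (local_knots X i) x)
      = (\<Sum>i=a..a + Suc q. \<omega> i * ?B i) + (\<Sum>i=a..a + Suc q. \<psi> (i + 1) * ?B (i + 1))"
    unfolding bspline_local_knots_Suc sum.distrib \<omega>_def \<psi>_def by (simp add: algebra_simps)
  also have "(\<Sum>i=a..a + Suc q. \<omega> i * ?B i) = (\<Sum>i\<in>?M. \<omega> i * ?B i)"
    using ends(1) by (simp add: sum.atLeast_Suc_atMost)
  also have "(\<Sum>i=a..a + Suc q. \<psi> (i + 1) * ?B (i + 1)) = (\<Sum>i=a + 1..a + q + 2. \<psi> i * ?B i)"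
    using sum.shift_bounds_cl_Suc_ivl[of "\<lambda>i. \<psi> i * ?B i" a "a + Suc q"] by simp
  also have "\<dots> = (\<Sum>i\<in>?M. \<psi> i * ?B i)"
    using ends(2) by (simp add: numeral_2_eq_2)
  also have "(\<Sum>i\<in>?M. \<omega> i * ?B i) + (\<Sum>i\<in>?M. \<psi> i * ?B i) = (\<Sum>i\<in>?M. (\<omega> i + \<psi> i) * ?B i)"
    by (simp add: sum.distrib distrib_right)
  also have "\<dots> = (\<Sum>i\<in>?M. ?B i)"
    using compl by (intro sum.cong) auto
  also have "\<dots> = 1"
    using Suc.prems by (intro Suc.IH) auto
  finally show ?case .
qed

lemma weighted_mean_bounds:
  assumes "\<And>x y. (x, y) \<in> P \<Longrightarrow> l \<le> y \<and> y \<le> u"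
    and "\<And>x. w t x \<ge> 0"
    and "(\<Sum>(x, y)\<in>P. w t x) > 0"
  shows "l \<le> weighted_mean P w t" and "weighted_mean P w t \<le> u"
proof -
  have "l * (\<Sum>(x, y)\<in>P. w t x) \<le> (\<Sum>(x, y)\<in>P. y * w t x)"
    unfolding sum_distrib_left using assms(1,2)
    by (intro sum_mono) (auto intro!: mult_right_mono)
  then show "l \<le> weighted_mean P w t"
    using assms(3) by (simp add: weighted_mean_def pos_le_divide_eq)
  have "(\<Sum>(x, y)\<in>P. y * w t x) \<le> u * (\<Sum>(x, y)\<in>P. w t x)"
    unfolding sum_distrib_left using assms(1,2)
    by (intro sum_mono) (auto intro!: mult_right_mono)
  then show "weighted_mean P w t \<le> u"
    using assms(3) by (simp add: weighted_mean_def pos_divide_le_eq)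
qed

lemma convex_combination_bounds:
  fixes b c :: "'a \<Rightarrow> real"
  assumes "\<And>i. i \<in> I \<Longrightarrow> b i \<ge> 0" and "(\<Sum>i\<in>I. b i) = 1"
    and "\<And>i. i \<in> I \<Longrightarrow> l \<le> c i \<and> c i \<le> u"
  shows "l \<le> (\<Sum>i\<in>I. c i * b i)" and "(\<Sum>i\<in>I. c i * b i) \<le> u"
proof -
  have "(\<Sum>i\<in>I. l * b i) \<le> (\<Sum>i\<in>I. c i * b i)"
    using assms(1,3) by (intro sum_mono mult_right_mono) auto
  then show "l \<le> (\<Sum>i\<in>I. c i * b i)"
    using assms(2) by (simp flip: sum_distrib_left)
  have "(\<Sum>i\<in>I. c i * b i) \<le> (\<Sum>i\<in>I. u * b i)"
    using assms(1,3) by (intro sum_mono mult_right_mono) auto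
  then show "(\<Sum>i\<in>I. c i * b i) \<le> u"
    using assms(2) by (simp flip: sum_distrib_left)
qed

theorem corollaryA2:
  fixes P :: "(real \<times> real) set"
    and ymin ymax :: real
    and p n :: nat
    and X :: "nat \<Rightarrow> real"
    and w :: "real \<Rightarrow> real \<Rightarrow> real"
  assumes "point_cloud P"
    and "\<And>x y. (x, y) \<in> P \<Longrightarrow> ymin \<le> y \<and> y \<le> ymax"
    and "p \<ge> 1"
    and "regular_knot_vector p n X"
    and "\<And>t x. w t x \<ge> 0"
    and "\<And>i. i \<in> {1..n} \<Longrightarrow> (\<Sum>(x, y)\<in>P. w (knot_average p X i) x) > 0"
  shows "\<forall>\<mu>\<in>{p + 1..n}. \<exists>\<alpha>\<in>{ymin..ymax}. \<exists>\<beta>\<in>{ymin..ymax}.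
           \<forall>x\<in>{X \<mu>..<X (\<mu> + 1)}. \<alpha> \<le> wQISA P w p n X x \<and> wQISA P w p n X x \<le> \<beta>"
proof
  fix \<mu> assume \<mu>: "\<mu> \<in> {p + 1..n}"
  have kv: "knot_vector (n + p + 1) X"
    using assms(4) by (simp add: regular_knot_vector_def)
  obtain x0 y0 where "(x0, y0) \<in> P"
    using assms(1) by (auto simp: point_cloud_def)
  with assms(2) have "ymin \<le> ymax" by fastforce
  moreover have "ymin \<le> wQISA P w p n X x \<and> wQISA P w p n X x \<le> ymax"
    if x: "x \<in> {X \<mu>..<X (\<mu> + 1)}" for x
  proof -
    have nonneg: "bspline p (local_knots X i) x \<ge> 0" if "i \<in> {1..n}" for i
      by (intro bspline_nonneg knot_vector_local_knots[OF kv]) (use that in auto)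
    have inactive: "bspline p (local_knots X i) x = 0" if "i \<in> {1..n} - {\<mu> - p..\<mu>}" for i
    proof (rule bspline_local_knots_eq_0[OF kv])
      have "i + p + 1 \<le> \<mu> \<or> \<mu> + 1 \<le> i" using that by auto
      then have "X (i + p + 1) \<le> X \<mu> \<or> X (\<mu> + 1) \<le> X i"
        using kv that \<mu> by (auto simp: knot_vector_def)
      then show "x < X i \<or> X (i + p + 1) \<le> x" using x by auto
    qed (use that in auto)
    have "(\<Sum>i=1..n. bspline p (local_knots X i) x)
        = (\<Sum>i=\<mu> - p..\<mu>. bspline p (local_knots X i) x)"
      using \<mu> inactive by (intro sum.mono_neutral_right) auto
    also have "\<dots> = 1"
      using sum_bspline_eq_1[OF kv, of "\<mu> - p" p x] \<mu> x by (simp add: le_diff_conv2)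
    finally have unity: "(\<Sum>i=1..n. bspline p (local_knots X i) x) = 1" .
    have coeff: "ymin \<le> weighted_mean P w (knot_average p X i)
        \<and> weighted_mean P w (knot_average p X i) \<le> ymax" if "i \<in> {1..n}" for i
      by (intro conjI weighted_mean_bounds assms(5) assms(6)[OF that]) (use assms(2) in blast)+
    show ?thesis
      unfolding wQISA_def
      by (intro conjI convex_combination_bounds(1)[OF nonneg unity coeff]
          convex_combination_bounds(2)[OF nonneg unity coeff])
  qed
  ultimately show "\<exists>\<alpha>\<in>{ymin..ymax}. \<exists>\<beta>\<in>{ymin..ymax}.
      \<forall>x\<in>{X \<mu>..<X (\<mu> + 1)}. \<alpha> \<le> wQISA P w p n X x \<and> wQISA P w p n X x \<le> \<beta>"
    by (intro bexI[of _ ymin] bexI[of _ ymax]) auto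
qed

end
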